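(* (Risk-averse perfectly rational agent: $\lambda\to+\infty$ and $\mu<0$.) Setting $U(x_1)\equiv0$ and taking the limit $\lambda\to+\infty$ in the bounded-rational action policy $p(x_1)$ (defined in the context), the perfectly rational actor with risk-sensitivity $\mu$ picks the action $$p(x_1)=\delta(x_1-x_1^* )\qquad\text{with}\qquad x_1^*=\arg\max_{x_1}\frac1\mu\log\sum_{x_2}p_0(x_2|x_1)\exp\big(\mu U(x_2|x_1)\big).$$
   Context: A decision-maker emits an action $x_1$ with default probability $p_0(x_1)$ and then expects an input $x_2$ with default probability $p_0(x_2|x_1)$; $U(x_1)$ and $U(x_2|x_1)$ are real-valued utilities of the two symbols. For parameters $\lambda$ (agent) and $\mu$ (environment), the bounded-rational action policy is $$p(x_1)=\frac{1}{Z_1}\,p_0(x_1)\exp\Big(\lambda\Big(U(x_1)+\tfrac1\mu\log\sum_{x_2}p_0(x_2|x_1)\exp\big(\mu U(x_2|x_1)\big)\Big)\Big),$$ where $Z_1$ is the normalization constant. $\delta(x_1-x_1^* )$ denotes the distribution concentrated at $x_1^*$.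
   Formalization: The arg max is taken over actions with positive default probability and assumed to exist and be unique (with ties, or a maximizer of default probability zero, the limit is not the stated delta); the sums over inputs are assumed to converge, which is automatic for finite alphabets. *)

theory Defs
  imports "HOL-Probability.Probability"
begin

text \<open>The alphabets are arbitrary types. A \<open>pmf\<close> has countable support, so the sums over symbols are
  unordered sums \<open>infsum\<close>, which are finite sums when the alphabets are finite. Where such a sum
  diverges, \<open>infsum\<close> has the value \<open>0\<close>, so summability has to be assumed or proved separately.
  Below, \<open>p0\<close> is the default distribution of the action and \<open>q0 x1\<close> the conditional default
  distribution of the input after the action \<open>x1\<close>.\<close>

definition certainty_equivalent ::
  "real \<Rightarrow> ('a \<Rightarrow> 'b pmf) \<Rightarrow> ('a \<Rightarrow> 'b \<Rightarrow> real) \<Rightarrow> 'a \<Rightarrow> real" where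
  "certainty_equivalent mu q0 U2 x1 =
     1 / mu * ln (\<Sum>\<^sub>\<infinity>x2. pmf (q0 x1) x2 * exp (mu * U2 x1 x2))"

definition action_weight ::
  "real \<Rightarrow> real \<Rightarrow> 'a pmf \<Rightarrow> ('a \<Rightarrow> 'b pmf) \<Rightarrow> ('a \<Rightarrow> real) \<Rightarrow> ('a \<Rightarrow> 'b \<Rightarrow> real) \<Rightarrow> 'a \<Rightarrow> real" where
  "action_weight lam mu p0 q0 U1 U2 x1 =
     pmf p0 x1 * exp (lam * (U1 x1 + certainty_equivalent mu q0 U2 x1))"

definition normalization_constant ::
  "real \<Rightarrow> real \<Rightarrow> 'a pmf \<Rightarrow> ('a \<Rightarrow> 'b pmf) \<Rightarrow> ('a \<Rightarrow> real) \<Rightarrow> ('a \<Rightarrow> 'b \<Rightarrow> real) \<Rightarrow> real" where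
  "normalization_constant lam mu p0 q0 U1 U2 = (\<Sum>\<^sub>\<infinity>x1. action_weight lam mu p0 q0 U1 U2 x1)"

definition action_policy ::
  "real \<Rightarrow> real \<Rightarrow> 'a pmf \<Rightarrow> ('a \<Rightarrow> 'b pmf) \<Rightarrow> ('a \<Rightarrow> real) \<Rightarrow> ('a \<Rightarrow> 'b \<Rightarrow> real) \<Rightarrow> 'a \<Rightarrow> real" where
  "action_policy lam mu p0 q0 U1 U2 x1 =
     1 / normalization_constant lam mu p0 q0 U1 U2 * action_weight lam mu p0 q0 U1 U2 x1"

end

(* Dividing weights and normalization constant by exp (lam * max V), with V the certainty
   equivalent, turns the normalization constant into the p0-expectation of
   exp (lam * (V - max V)). For lam >= 0 the integrand is bounded by 1 on the support of p0 and
   it tends to the indicator of the unique maximizer, so dominated convergence applies, and no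
   finiteness of the action set is needed. *)
theory Submission imports Defs begin

text \<open>Links the unordered sums of the definitions to integrals, for which dominated
  convergence is available. Since \<open>pmf p\<close> is the density of \<open>p\<close>,
  integrability against \<open>p\<close> is absolute summability of the weighted function.\<close>

lemma pmf_expectation_eq_infsum:
  fixes f :: "'a \<Rightarrow> real"
  assumes "integrable (measure_pmf p) f"
  shows "measure_pmf.expectation p f = (\<Sum>\<^sub>\<infinity>x. pmf p x * f x)"
proof -
  have "integrable (count_space UNIV) (\<lambda>x. pmf p x * f x)"
    using assms unfolding measure_pmf_eq_density by (subst (asm) integrable_density) simp_all
  then have "infsetsum (\<lambda>x. pmf p x * f x) UNIV = (\<Sum>\<^sub>\<infinity>x. pmf p x * f x)"
    by (intro infsetsum_infsum) (simp add: abs_summable_equivalent abs_summable_on_def)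
  then show ?thesis
    by (simp add: pmf_expectation_eq_infsetsum)
qed

lemma tendsto_exp_mult_at_top:
  fixes d :: real
  assumes "d \<le> 0"
  shows "((\<lambda>lam. exp (lam * d)) \<longlongrightarrow> (if d = 0 then 1 else 0)) at_top"
proof (cases "d = 0")
  case False
  then have "filterlim (\<lambda>lam. d * lam) at_bot at_top"
    using assms by (intro filterlim_tendsto_neg_mult_at_bot[OF tendsto_const]) (auto simp: filterlim_ident)
  then show ?thesis
    using False by (auto intro: filterlim_compose[OF exp_at_bot] simp: mult.commute)
qed simp

context
  fixes p :: "'a pmf" and V :: "'a \<Rightarrow> real" and a :: 'a
  assumes a: "a \<in> set_pmf p"
    and max: "\<And>x. x \<in> set_pmf p \<Longrightarrow> x \<noteq> a \<Longrightarrow> V x < V a"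
begin

lemma exp_mult_diff_max_tendsto:
  assumes "x \<in> set_pmf p"
  shows "((\<lambda>lam. exp (lam * (V x - V a))) \<longlongrightarrow> indicator {a} x) at_top"
  using tendsto_exp_mult_at_top[of "V x - V a"] max[OF assms] by (cases "x = a") auto

lemma exp_mult_diff_max_le_1:
  assumes "x \<in> set_pmf p" and "lam \<ge> 0"
  shows "exp (lam * (V x - V a)) \<le> 1"
  using max[OF assms(1)] assms(2) by (cases "x = a") (auto simp: mult_nonneg_nonpos)

lemma integrable_exp_mult_diff_max:
  assumes "lam \<ge> 0"
  shows "integrable (measure_pmf p) (\<lambda>x. exp (lam * (V x - V a)))"
  using exp_mult_diff_max_le_1 assms
  by (intro measure_pmf.integrable_const_bound[where B = 1]) (auto simp: AE_measure_pmf_iff simp del: exp_le_one_iff)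

lemma infsum_exp_mult_diff_max_tendsto:
  "((\<lambda>lam. \<Sum>\<^sub>\<infinity>x. pmf p x * exp (lam * (V x - V a))) \<longlongrightarrow> pmf p a) at_top"
proof -
  have "((\<lambda>lam. measure_pmf.expectation p (\<lambda>x. exp (lam * (V x - V a))))
          \<longlongrightarrow> measure_pmf.expectation p (indicator {a})) at_top"
  proof (rule integral_dominated_convergence_at_top[where w = "\<lambda>_. 1"])
    \<comment> \<open>For negative \<open>lam\<close> the integrand can be unbounded, so the bound
      holds only eventually. The constant 1 is integrable because \<open>p\<close> is a probability
      measure.\<close>
    show "\<forall>\<^sub>F lam in at_top. AE x in measure_pmf p. norm (exp (lam * (V x - V a))) \<le> 1"
      using eventually_ge_at_top[of 0]
      by eventually_elim (auto simp: AE_measure_pmf_iff exp_mult_diff_max_le_1 simp del: exp_le_one_iff)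
    show "AE x in measure_pmf p. ((\<lambda>lam. exp (lam * (V x - V a))) \<longlongrightarrow> indicator {a} x) at_top"
      by (auto simp: AE_measure_pmf_iff exp_mult_diff_max_tendsto)
  qed auto
  moreover have "\<forall>\<^sub>F lam in at_top. measure_pmf.expectation p (\<lambda>x. exp (lam * (V x - V a)))
      = (\<Sum>\<^sub>\<infinity>x. pmf p x * exp (lam * (V x - V a)))"
    using eventually_ge_at_top[of 0]
    by eventually_elim (intro pmf_expectation_eq_infsum integrable_exp_mult_diff_max)
  ultimately show ?thesis
    by (simp add: tendsto_cong measure_pmf_single)
qed

lemma gibbs_weight_tendsto_return_pmf:
  "((\<lambda>lam. pmf p x * exp (lam * V x) / (\<Sum>\<^sub>\<infinity>y. pmf p y * exp (lam * V y)))
      \<longlongrightarrow> pmf (return_pmf a) x) at_top"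
proof -
  have shift: "pmf p y * exp (lam * V y)
      = exp (lam * V a) * (pmf p y * exp (lam * (V y - V a)))" for y lam
    by (simp add: right_diff_distrib exp_diff)
  \<comment> \<open>The factor \<open>exp (lam * V a)\<close> cancels for every \<open>lam\<close>,
    even where the sums diverge: both then have the default value 0.\<close>
  have "pmf p x * exp (lam * V x) / (\<Sum>\<^sub>\<infinity>y. pmf p y * exp (lam * V y))
      = pmf p x * exp (lam * (V x - V a)) / (\<Sum>\<^sub>\<infinity>y. pmf p y * exp (lam * (V y - V a)))" for lam
    unfolding shift infsum_cmult_right' by simp
  moreover have "((\<lambda>lam. pmf p x * exp (lam * (V x - V a))) \<longlongrightarrow> pmf p x * indicator {a} x) at_top"
  \<comment> \<open>Off the support \<open>V\<close> is not controlled and the exponential may blow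
    up, but there the factor \<open>pmf p x\<close> is 0.\<close>
  proof (cases "x \<in> set_pmf p")
    case True
    then show ?thesis
      by (intro tendsto_mult_left exp_mult_diff_max_tendsto)
  qed (simp add: set_pmf_iff)
  \<comment> \<open>The limit \<open>pmf p a\<close> of the denominator is nonzero because
    \<open>a\<close> lies in the support.\<close>
  then have "((\<lambda>lam. pmf p x * exp (lam * (V x - V a)) /
        (\<Sum>\<^sub>\<infinity>y. pmf p y * exp (lam * (V y - V a)))) \<longlongrightarrow> pmf p x * indicator {a} x / pmf p a) at_top"
    using a by (intro tendsto_divide infsum_exp_mult_diff_max_tendsto) (auto simp: set_pmf_iff)
  moreover have "pmf p x * indicator {a} x / pmf p a = pmf (return_pmf a) x"
    using a by (auto simp: set_pmf_iff indicator_def)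
  ultimately show ?thesis
    by simp
qed

end

theorem mainTheorem3:
  fixes p0 :: "'a pmf"
    and q0 :: "'a \<Rightarrow> 'b pmf"
    and U1 :: "'a \<Rightarrow> real"
    and U2 :: "'a \<Rightarrow> 'b \<Rightarrow> real"
    and mu :: real
    and xstar :: 'a
  assumes "mu < 0"
    and "\<And>x1. U1 x1 = 0"
    and "\<And>x1. x1 \<in> set_pmf p0 \<Longrightarrow>
           (\<lambda>x2. pmf (q0 x1) x2 * exp (mu * U2 x1 x2)) summable_on UNIV"
    and "\<exists>!x1. is_arg_max (certainty_equivalent mu q0 U2) (\<lambda>x. x \<in> set_pmf p0) x1"
    and "xstar = arg_max (certainty_equivalent mu q0 U2) (\<lambda>x. x \<in> set_pmf p0)"
  shows "\<forall>x1. ((\<lambda>lam. action_policy lam mu p0 q0 U1 U2 x1) \<longlongrightarrow> pmf (return_pmf xstar) x1) at_top"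
proof
  fix x1
  let ?V = "certainty_equivalent mu q0 U2"
  \<comment> \<open>\<open>arg_max\<close> is a Hilbert choice; existence of a maximizer makes the
    chosen value one.\<close>
  have arg_max: "is_arg_max ?V (\<lambda>x. x \<in> set_pmf p0) xstar"
    unfolding assms(5) arg_max_def using assms(4) by (auto intro: someI_ex)
  \<comment> \<open>Uniqueness gives strictness: in a linear order, a competitor not below the
    maximum is itself a maximizer.\<close>
  have less: "?V x < ?V xstar" if "x \<in> set_pmf p0" "x \<noteq> xstar" for x
  proof (rule ccontr)
    assume "\<not> ?V x < ?V xstar"
    then have "is_arg_max ?V (\<lambda>x. x \<in> set_pmf p0) x"
      using arg_max that(1) unfolding is_arg_max_linorder by force
    then show False
      using assms(4) arg_max that(2) by blast
  qed
  have "xstar \<in> set_pmf p0"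
    using arg_max by (simp add: is_arg_max_def)
  \<comment> \<open>As \<open>U1\<close> vanishes, the exponent is \<open>lam * ?V x1\<close> with
    \<open>?V\<close> independent of \<open>lam\<close>, so the policy is a Gibbs weight for
    \<open>?V\<close>.\<close>
  from gibbs_weight_tendsto_return_pmf[where V = ?V, OF this less]
  show "((\<lambda>lam. action_policy lam mu p0 q0 U1 U2 x1) \<longlongrightarrow> pmf (return_pmf xstar) x1) at_top"
    by (simp add: action_policy_def normalization_constant_def action_weight_def assms(2))
qed

end
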